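(* Let $G$ be a graph with two distinct non-adjacent vertices $u$ and $v$ such that $N(u)\subseteq N(v)$. Then at least one of the following holds: (i) $G$ is recolorable; (ii) $G-u$ is not recolorable. Furthermore, if $G-u$ is good then $G$ is good.
   Context: All graphs are finite and simple. $N(v)$ is the set of vertices adjacent to $v$. A $k$-coloring of $G$ is a map $V(G)\to\{1,\dots,k\}$ giving adjacent vertices different values; $\chi(G)$ is the chromatic number, and a $\chi$-coloring of $G$ is a $\chi(G)$-coloring. $R_k(G)$ denotes the graph whose vertices are the $k$-colorings of $G$, two being adjacent if they differ in color on exactly one vertex. $G$ is recolorable if $R_\ell(G)$ is connected for all $\ell\ge\chi(G)+1$. A graph $G$ on $n$ vertices is good if there exists a $\chi$-coloring of $G$ which, for all $\ell\ge\chi(G)+1$, can be reached from any coloring in $R_\ell(G)$ by a path in $R_\ell(G)$ along which each vertex is recolored at most $n$ times (for $G-u$, $n$ is the number of vertices of $G-u$). $G-u$ is the graph obtained from $G$ by deleting $u$. *)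

theory Defs
  imports "Graph_Theory.Graph_Theory" "HOL-Library.FuncSet"
begin

text \<open>
  A finite simple graph is the locale \<^locale>\<open>graph\<close>: a finite, symmetric, loop-free digraph without
  parallel arcs, so every undirected edge is a pair of opposite arcs.
\<close>

definition neighborhood :: "('a, 'b) pre_digraph \<Rightarrow> 'a \<Rightarrow> 'a set" where
  "neighborhood G v = {w. v \<rightarrow>\<^bsub>G\<^esub> w}"

text \<open>
  Colorings are extensional (undefined outside the vertex set), so that each map from the vertices
  to the colors is represented by exactly one function.
\<close>

definition colorings :: "('a, 'b) pre_digraph \<Rightarrow> nat \<Rightarrow> ('a \<Rightarrow> nat) set" where
  "colorings G k =
    {c \<in> verts G \<rightarrow>\<^sub>E {1..k}. \<forall>x\<in>verts G. \<forall>y\<in>verts G. x \<rightarrow>\<^bsub>G\<^esub> y \<longrightarrow> c x \<noteq> c y}"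

definition chromatic_number :: "('a, 'b) pre_digraph \<Rightarrow> nat" where
  "chromatic_number G = (LEAST k. colorings G k \<noteq> {})"

definition recoloring_graph :: "('a, 'b) pre_digraph \<Rightarrow> nat \<Rightarrow> ('a \<Rightarrow> nat) pair_pre_digraph" where
  "recoloring_graph G k =
    \<lparr> pverts = colorings G k,
      parcs = {(c, d). c \<in> colorings G k \<and> d \<in> colorings G k \<and> (\<exists>!x. x \<in> verts G \<and> c x \<noteq> d x)} \<rparr>"

definition recolorable :: "('a, 'b) pre_digraph \<Rightarrow> bool" where
  "recolorable G \<longleftrightarrow>
    (\<forall>l \<ge> chromatic_number G + 1. Digraph_Component.connected (with_proj (recoloring_graph G l)))"

text \<open>A path in a recoloring graph is a list of arcs, each of which is a pair of colorings.\<close>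

definition recolor_count :: "(('a \<Rightarrow> nat) \<times> ('a \<Rightarrow> nat)) list \<Rightarrow> 'a \<Rightarrow> nat" where
  "recolor_count p x = length (filter (\<lambda>(c, d). c x \<noteq> d x) p)"

definition good :: "('a, 'b) pre_digraph \<Rightarrow> bool" where
  "good G \<longleftrightarrow>
    (\<exists>c\<^sub>0 \<in> colorings G (chromatic_number G).
      \<forall>l \<ge> chromatic_number G + 1. \<forall>c \<in> colorings G l.
        \<exists>p. pre_digraph.apath (with_proj (recoloring_graph G l)) c p c\<^sub>0 \<and>
            (\<forall>x \<in> verts G. recolor_count p x \<le> card (verts G)))"

lemma colorings_nonempty:
  assumes "graph G"
  shows "colorings G (chromatic_number G) \<noteq> {}"
proof -
  interpret graph G by fact
  obtain f :: "'a \<Rightarrow> nat" where f: "bij_betw f (verts G) {1..card (verts G)}"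
    using ex_bij_betw_finite_nat[OF finite_verts] bij_betw_trans
      ex_bij_betw_nat_finite_1[OF finite_verts] bij_betw_inv by blast
  have "c x \<noteq> c y" if "x \<in> verts G" "y \<in> verts G" "x \<rightarrow>\<^bsub>G\<^esub> y" "c = restrict f (verts G)" for c x y
    using that f adj_not_same by (auto simp: bij_betw_def inj_on_def)
  then have "restrict f (verts G) \<in> colorings G (card (verts G))"
    using f unfolding colorings_def by (auto simp: bij_betw_def)
  then show ?thesis
    unfolding chromatic_number_def by (intro LeastI[of "\<lambda>k. colorings G k \<noteq> {}"]) blast
qed

lemma pair_graph_recoloring_graph:
  assumes "graph G"
  shows "pair_graph (recoloring_graph G k)"
proof -
  interpret graph G by fact
  have fin: "finite (colorings G k)"
    unfolding colorings_def by (rule finite_subset[of _ "verts G \<rightarrow>\<^sub>E {1..k}"]) (auto intro: finite_PiE)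
  have "finite (parcs (recoloring_graph G k))"
    by (rule finite_subset[of _ "colorings G k \<times> colorings G k"])
      (auto simp: recoloring_graph_def fin)
  moreover have "sym (parcs (recoloring_graph G k))"
    by (auto simp: sym_def recoloring_graph_def eq_commute)
  ultimately show ?thesis
    by unfold_locales (use fin in \<open>auto simp: recoloring_graph_def symmetric_def\<close>)
qed

end

theory Submission
  imports Defs
begin

text \<open>
  Giving \<open>u\<close> the color of \<open>v\<close> extends any coloring of \<open>G - u\<close> to \<open>G\<close>, because \<open>N(u) \<subseteq> N(v)\<close>.
  A recoloring sequence of \<open>G - u\<close> therefore lifts to \<open>G\<close> by letting \<open>u\<close> copy every color change of
  \<open>v\<close> immediately after it happens. An arbitrary coloring of \<open>G\<close> is brought into the form where \<open>u\<close>
  has the color of \<open>v\<close> by recoloring \<open>u\<close> once, so \<open>u\<close> is recolored at most once more often than \<open>v\<close>,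
  which fits because \<open>G\<close> has one vertex more than \<open>G - u\<close>.
\<close>

section \<open>Vertex deletion\<close>

lemma (in pre_digraph) adj_del_vert_iff:
  "x \<rightarrow>\<^bsub>del_vert u\<^esub> y \<longleftrightarrow> x \<rightarrow>\<^bsub>G\<^esub> y \<and> x \<noteq> u \<and> y \<noteq> u"
  by (auto simp: arcs_ends_def arc_to_ends_def del_vert_simps)

lemma (in graph) graph_del_vert: "graph (del_vert u)"
proof -
  interpret H: fin_digraph "del_vert u" by (rule fin_digraph_del_vert)
  have "symmetric (del_vert u)"
    unfolding symmetric_def
    by (intro symI) (auto simp: adj_del_vert_iff intro: graph_symmetric)
  moreover have "tail (del_vert u) e \<noteq> head (del_vert u) e" if "e \<in> arcs (del_vert u)" for e
    using that no_loops by (auto simp: del_vert_simps)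
  moreover have "e1 = e2"
    if "e1 \<in> arcs (del_vert u)" "e2 \<in> arcs (del_vert u)"
      "arc_to_ends (del_vert u) e1 = arc_to_ends (del_vert u) e2" for e1 e2
    using that no_multi_arcs by (auto simp: del_vert_simps ends_del_vert)
  ultimately show ?thesis by unfold_locales
qed

section \<open>Walks in recoloring graphs\<close>

abbreviation recoloring_walk where
  "recoloring_walk G k \<equiv> pre_digraph.awalk (with_proj (recoloring_graph G k))"

lemma pverts_recoloring_graph: "pverts (recoloring_graph G k) = colorings G k"
  by (simp add: recoloring_graph_def)

lemma arc_recoloring_graph_iff:
  "(c, d) \<in> parcs (recoloring_graph G k) \<longleftrightarrow>
    c \<in> colorings G k \<and> d \<in> colorings G k \<and> (\<exists>!x. x \<in> verts G \<and> c x \<noteq> d x)"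
  by (simp add: recoloring_graph_def)

lemma recolor_count_append:
  "recolor_count (p @ q) x = recolor_count p x + recolor_count q x"
  by (simp add: recolor_count_def)

text \<open>An arc joins colorings that differ at exactly one vertex. The list form admits the empty
  walk, so a recoloring that may turn out to change nothing needs no case distinction later.\<close>

definition recolor_step :: "('a \<Rightarrow> nat) \<Rightarrow> ('a \<Rightarrow> nat) \<Rightarrow> (('a \<Rightarrow> nat) \<times> ('a \<Rightarrow> nat)) list" where
  "recolor_step c d = (if c = d then [] else [(c, d)])"

lemma recolor_count_step: "recolor_count (recolor_step c d) x = of_bool (c x \<noteq> d x)"
  by (auto simp: recolor_count_def recolor_step_def)

context graph
begin

lemma recoloring_walk_Nil_iff:
  "recoloring_walk G k c [] d \<longleftrightarrow> c = d \<and> c \<in> colorings G k"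
proof -
  interpret R: pair_graph "recoloring_graph G k" by (rule pair_graph_recoloring_graph) unfold_locales
  show ?thesis by (auto simp: R.awalk_Nil_iff pverts_recoloring_graph)
qed

lemma recoloring_walk_Cons_iff:
  "recoloring_walk G k c (e # p) d \<longleftrightarrow>
    e \<in> parcs (recoloring_graph G k) \<and> c = fst e \<and> recoloring_walk G k (snd e) p d"
proof -
  interpret R: pair_graph "recoloring_graph G k" by (rule pair_graph_recoloring_graph) unfold_locales
  show ?thesis by (rule R.awalk_Cons_iff)
qed

lemma recoloring_walk_append:
  assumes "recoloring_walk G k c p d" "recoloring_walk G k d q e"
  shows "recoloring_walk G k c (p @ q) e"
proof -
  interpret R: pair_graph "recoloring_graph G k" by (rule pair_graph_recoloring_graph) unfold_locales
  show ?thesis using assms by (rule R.awalk_appendI)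
qed

lemma recoloring_walk_step:
  assumes "c \<in> colorings G k" "d \<in> colorings G k" "x \<in> verts G" "\<And>y. y \<noteq> x \<Longrightarrow> c y = d y"
  shows "recoloring_walk G k c (recolor_step c d) d"
proof (cases "c = d")
  case False
  then have "c x \<noteq> d x" using assms(4) by (metis ext)
  then have "\<exists>!y. y \<in> verts G \<and> c y \<noteq> d y" using assms(3,4) by metis
  with False assms(1,2) show ?thesis
    by (simp add: recolor_step_def recoloring_walk_Cons_iff recoloring_walk_Nil_iff
        arc_recoloring_graph_iff)
qed (use assms(2) in \<open>simp add: recolor_step_def recoloring_walk_Nil_iff\<close>)

text \<open>The arcs form a symmetric relation, so connectedness, defined through the symmetric
  closure, coincides with strong connectedness.\<close>

lemma connected_recoloring_graph_iff:
  "Digraph_Component.connected (with_proj (recoloring_graph G k)) \<longleftrightarrow>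
    colorings G k \<noteq> {} \<and> (\<forall>c\<in>colorings G k. \<forall>d\<in>colorings G k. \<exists>p. recoloring_walk G k c p d)"
proof -
  interpret R: pair_graph "recoloring_graph G k" by (rule pair_graph_recoloring_graph) unfold_locales
  have "Digraph_Component.connected (with_proj (recoloring_graph G k)) \<longleftrightarrow>
      strongly_connected (with_proj (recoloring_graph G k))"
    unfolding connected_def strongly_connected_def
    by (simp add: R.reachable_mk_symmetric_eq[OF R.sym_arcs])
  then show ?thesis
    by (simp add: strongly_connected_def R.reachable_awalk pverts_recoloring_graph)
qed

text \<open>Lifted sequences are built as walks, which concatenate freely, whereas
  \<open>good\<close> asks for paths. Cutting out a cycle only removes arcs, so no count
  increases.\<close>

lemma recoloring_apath_of_walk:
  assumes "recoloring_walk G k c p d"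
  shows "\<exists>q. pre_digraph.apath (with_proj (recoloring_graph G k)) c q d \<and>
    (\<forall>x. recolor_count q x \<le> recolor_count p x)"
proof -
  interpret R: pair_graph "recoloring_graph G k" by (rule pair_graph_recoloring_graph) unfold_locales
  show ?thesis using assms
  proof (induction rule: R.awalk_to_apath_induct)
    case (path p)
    then show ?case by (auto simp: R.apath_def)
  next
    case (decomp p q r s)
    have "p = q @ r @ s" by (rule R.awalk_cyc_decompE[OF decomp(2,1,3)])
    then have "recolor_count (q @ s) x \<le> recolor_count p x" for x
      by (simp add: recolor_count_append)
    with decomp(4) show ?case by (meson order_trans)
  qed
qed

end

section \<open>Colorings of \<open>G\<close> and of \<open>G - u\<close>\<close>

locale dominated_vertex = graph G for G :: "('a, 'b) pre_digraph" (structure) +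
  fixes u v :: 'a
  assumes u_in: "u \<in> verts G" and v_in: "v \<in> verts G" and u_neq_v: "u \<noteq> v"
    and nbhd_subset: "neighborhood G u \<subseteq> neighborhood G v"
begin

sublocale H: graph "del_vert u" by (rule graph_del_vert)

definition extend :: "('a \<Rightarrow> nat) \<Rightarrow> 'a \<Rightarrow> nat" where
  "extend c = c(u := c v)"

lemma dominated: "u \<rightarrow>\<^bsub>G\<^esub> w \<Longrightarrow> v \<rightarrow>\<^bsub>G\<^esub> w"
  using nbhd_subset by (auto simp: neighborhood_def)

text \<open>The color \<open>a\<close> is left general because it is needed twice: as the color of
  \<open>v\<close> in \<open>extend\<close>, and as the outdated color of \<open>v\<close> in the
  middle of a lifted step.\<close>

lemma coloring_upd:
  assumes "c \<in> colorings (del_vert u) k" "a \<in> {1..k}" "\<And>w. u \<rightarrow>\<^bsub>G\<^esub> w \<Longrightarrow> c w \<noteq> a"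
  shows "c(u := a) \<in> colorings G k"
proof -
  have "c \<in> (verts G - {u}) \<rightarrow>\<^sub>E {1..k}"
    using assms(1) by (simp add: colorings_def del_vert_simps)
  then have "c(u := a) \<in> insert u (verts G - {u}) \<rightarrow>\<^sub>E {1..k}"
    using assms(2) by (intro PiE_fun_upd) auto
  then have "c(u := a) \<in> verts G \<rightarrow>\<^sub>E {1..k}" using u_in by (simp add: insert_absorb)
  moreover have "(c(u := a)) x \<noteq> (c(u := a)) y"
    if "x \<in> verts G" "y \<in> verts G" "x \<rightarrow>\<^bsub>G\<^esub> y" for x y
  proof -
    \<comment> \<open>The hypothesis on \<open>a\<close> speaks of arcs leaving \<open>u\<close>;
      the reversed arc covers the case \<open>y = u\<close>.\<close>
    have "y \<rightarrow>\<^bsub>G\<^esub> x" using that(3) graph_symmetric by blast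
    then show ?thesis
      using that assms(1) assms(3)[of x] assms(3)[of y] adj_not_same
      by (auto simp: colorings_def adj_del_vert_iff del_vert_simps)
  qed
  ultimately show ?thesis by (simp add: colorings_def)
qed

text \<open>By domination \<open>w\<close> is also a neighbor of \<open>v\<close>, and this edge
  avoids \<open>u\<close>, so it survives in \<open>G - u\<close>.\<close>

lemma coloring_neq:
  assumes "c \<in> colorings (del_vert u) k" "u \<rightarrow>\<^bsub>G\<^esub> w"
  shows "c w \<noteq> c v"
proof -
  have "v \<rightarrow>\<^bsub>G\<^esub> w" "w \<noteq> u" using assms(2) dominated adj_not_same by auto
  then show ?thesis
    using assms(1) u_neq_v v_in adj_in_verts[of v w]
    by (fastforce simp: colorings_def adj_del_vert_iff del_vert_simps)
qed

lemma coloring_in_range: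
  assumes "c \<in> colorings (del_vert u) k" shows "c v \<in> {1..k}"
proof -
  have "c \<in> (verts G - {u}) \<rightarrow>\<^sub>E {1..k}" using assms by (simp add: colorings_def del_vert_simps)
  then show ?thesis using v_in u_neq_v by (blast intro: PiE_mem)
qed

lemma extend_coloring:
  "c \<in> colorings (del_vert u) k \<Longrightarrow> extend c \<in> colorings G k"
  unfolding extend_def by (intro coloring_upd coloring_in_range coloring_neq)

lemma restrict_coloring:
  "c \<in> colorings G k \<Longrightarrow> restrict c (verts G - {u}) \<in> colorings (del_vert u) k"
  by (auto simp: colorings_def del_vert_simps adj_del_vert_iff)

text \<open>Extension and restriction keep the number of colors. Hence the range of \<open>l\<close>
  in \<open>recolorable\<close> and \<open>good\<close> is the same for both graphs.\<close>

lemma chromatic_number_del_vert: "chromatic_number (del_vert u) = chromatic_number G"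
proof -
  have "colorings (del_vert u) k \<noteq> {} \<longleftrightarrow> colorings G k \<noteq> {}" for k
    using extend_coloring restrict_coloring by fastforce
  then show ?thesis by (simp add: chromatic_number_def)
qed

section \<open>Lifting recoloring walks\<close>

text \<open>First \<open>x\<close> is recolored, then \<open>u\<close> is adjusted; the second step
  is nontrivial only if \<open>x = v\<close>. So the recolorings of \<open>u\<close> are charged to
  \<open>v\<close>, those of any other vertex to itself.\<close>

lemma recoloring_walk_extend_arc:
  assumes "(c, d) \<in> parcs (recoloring_graph (del_vert u) k)"
  shows "\<exists>q. recoloring_walk G k (extend c) q (extend d) \<and>
    (\<forall>y. recolor_count q y \<le> recolor_count [(c, d)] (if y = u then v else y))"
proof -
  have cd: "c \<in> colorings (del_vert u) k" "d \<in> colorings (del_vert u) k"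
    using assms by (simp_all add: arc_recoloring_graph_iff)
  obtain x where x: "x \<in> verts (del_vert u)" and
    "\<And>y. y \<in> verts (del_vert u) \<Longrightarrow> y \<noteq> x \<Longrightarrow> c y = d y"
    using assms unfolding arc_recoloring_graph_iff by blast
  \<comment> \<open>Both colorings are \<open>undefined\<close> outside \<open>G - u\<close>, in
    particular at \<open>u\<close>.\<close>
  moreover have "c y = d y" if "y \<notin> verts (del_vert u)" for y
    using cd that by (auto simp: colorings_def PiE_def extensional_def)
  ultimately have same: "c y = d y" if "y \<noteq> x" for y using that by blast
  have xG: "x \<in> verts G" "x \<noteq> u" using x by (auto simp: del_vert_simps)
  \<comment> \<open>The coloring in between: \<open>x\<close> already has its new color, \<open>u\<close> still has the old color of \<open>v\<close>.\<close>
  define m where "m = d(u := c v)"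
  \<comment> \<open>This is what makes the mixed coloring \<open>m\<close> proper. If
    \<open>w\<close> is the recolored vertex, then it is adjacent to \<open>v\<close>, so
    \<open>v\<close> kept its color and properness of \<open>d\<close> applies; otherwise
    \<open>w\<close> kept its color and properness of \<open>c\<close> applies.\<close>
  have "d w \<noteq> c v" if "u \<rightarrow>\<^bsub>G\<^esub> w" for w
  proof (cases "w = x")
    case True
    then have "v \<noteq> x" using that dominated adj_not_same by metis
    then show ?thesis using same[of v] coloring_neq[OF cd(2) that] by simp
  next
    case False
    then show ?thesis using same coloring_neq[OF cd(1) that] by metis
  qed
  then have m: "m \<in> colorings G k"
    unfolding m_def by (intro coloring_upd cd coloring_in_range[OF cd(1)])
  let ?q = "recolor_step (extend c) m @ recolor_step m (extend d)"
  have "recoloring_walk G k (extend c) ?q (extend d)"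
  proof (rule recoloring_walk_append)
    show "recoloring_walk G k (extend c) (recolor_step (extend c) m) m"
      using extend_coloring[OF cd(1)] m xG same
      by (intro recoloring_walk_step[where x = x]) (auto simp: m_def extend_def)
    show "recoloring_walk G k m (recolor_step m (extend d)) (extend d)"
      using extend_coloring[OF cd(2)] m u_in
      by (intro recoloring_walk_step[where x = u]) (auto simp: m_def extend_def)
  qed
  moreover have "recolor_count ?q y \<le> recolor_count [(c, d)] (if y = u then v else y)" for y
    unfolding recolor_count_append recolor_count_step
    by (auto simp: recolor_count_def m_def extend_def)
  ultimately show ?thesis by blast
qed

lemma recoloring_walk_extend:
  assumes "recoloring_walk (del_vert u) k c p d"
  shows "\<exists>q. recoloring_walk G k (extend c) q (extend d) \<and>
    (\<forall>y. recolor_count q y \<le> recolor_count p (if y = u then v else y))"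
  using assms
proof (induction p arbitrary: c)
  case Nil
  then show ?case
    by (intro exI[of _ "[]"])
      (auto simp: H.recoloring_walk_Nil_iff recoloring_walk_Nil_iff extend_coloring recolor_count_def)
next
  case (Cons e p)
  obtain c' where e: "e = (c, c')" "(c, c') \<in> parcs (recoloring_graph (del_vert u) k)"
    and p: "recoloring_walk (del_vert u) k c' p d"
    using Cons.prems by (cases e) (auto simp: H.recoloring_walk_Cons_iff)
  obtain q1 where q1: "recoloring_walk G k (extend c) q1 (extend c')"
    "\<And>y. recolor_count q1 y \<le> recolor_count [e] (if y = u then v else y)"
    using recoloring_walk_extend_arc[OF e(2)] e(1) by blast
  obtain q2 where q2: "recoloring_walk G k (extend c') q2 (extend d)"
    "\<And>y. recolor_count q2 y \<le> recolor_count p (if y = u then v else y)"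
    using Cons.IH[OF p] by blast
  have "recolor_count (q1 @ q2) y \<le> recolor_count (e # p) (if y = u then v else y)" for y
    using add_mono[OF q1(2) q2(2)] recolor_count_append[of "[e]" p]
    by (simp add: recolor_count_append)
  then show ?case using recoloring_walk_append[OF q1(1) q2(1)] by blast
qed

text \<open>The two colorings differ at most at \<open>u\<close>. The first walk enters the lifted
  part of the recoloring graph, the second leaves it again.\<close>

lemma recoloring_walk_extend_restrict:
  assumes "c \<in> colorings G k"
  defines "c' \<equiv> extend (restrict c (verts G - {u}))"
  shows "recoloring_walk G k c (recolor_step c c') c'" "recoloring_walk G k c' (recolor_step c' c) c"
proof -
  have same: "c y = c' y" if "y \<noteq> u" for y
    using that assms(1) unfolding c'_def extend_def
    by (auto simp: colorings_def PiE_def extensional_def)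
  have c': "c' \<in> colorings G k"
    unfolding c'_def by (intro extend_coloring restrict_coloring assms)
  show "recoloring_walk G k c (recolor_step c c') c'" "recoloring_walk G k c' (recolor_step c' c) c"
    by (rule recoloring_walk_step[where x = u]; simp add: same c' assms(1) u_in)+
qed

section \<open>Transfer from \<open>G - u\<close> to \<open>G\<close>\<close>

text \<open>Move \<open>u\<close> to the color of \<open>v\<close>, follow a lifted walk between the
  restrictions, then give \<open>u\<close> its final color.\<close>

lemma recolorable_if_recolorable_del_vert:
  assumes "recolorable (del_vert u)"
  shows "recolorable G"
  unfolding recolorable_def connected_recoloring_graph_iff
proof (intro allI impI conjI ballI)
  fix k assume k: "k \<ge> chromatic_number G + 1"
  then have H: "colorings (del_vert u) k \<noteq> {}"
    "\<And>c d. c \<in> colorings (del_vert u) k \<Longrightarrow> d \<in> colorings (del_vert u) k \<Longrightarrow>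
      \<exists>p. recoloring_walk (del_vert u) k c p d"
    using assms
    by (auto simp: recolorable_def chromatic_number_del_vert H.connected_recoloring_graph_iff)
  show "colorings G k \<noteq> {}" using H(1) extend_coloring by blast
  fix c d assume c: "c \<in> colorings G k" and d: "d \<in> colorings G k"
  then obtain p where
    "recoloring_walk (del_vert u) k (restrict c (verts G - {u})) p (restrict d (verts G - {u}))"
    using H(2) restrict_coloring by blast
  then obtain q where "recoloring_walk G k (extend (restrict c (verts G - {u}))) q
      (extend (restrict d (verts G - {u})))"
    using recoloring_walk_extend by blast
  then show "\<exists>p. recoloring_walk G k c p d"
    using recoloring_walk_extend_restrict(1)[OF c] recoloring_walk_extend_restrict(2)[OF d]
      recoloring_walk_append by blast
qed

text \<open>The common target is \<open>extend c0\<close>, where \<open>c0\<close> is the target for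
  \<open>G - u\<close>. Only the entering step adds to the lifted counts.\<close>

lemma good_if_good_del_vert:
  assumes "good (del_vert u)"
  shows "good G"
proof -
  obtain c0 where c0: "c0 \<in> colorings (del_vert u) (chromatic_number G)" and
    reach: "\<And>k c. k \<ge> chromatic_number G + 1 \<Longrightarrow> c \<in> colorings (del_vert u) k \<Longrightarrow>
      \<exists>p. pre_digraph.apath (with_proj (recoloring_graph (del_vert u) k)) c p c0 \<and>
        (\<forall>x\<in>verts (del_vert u). recolor_count p x \<le> card (verts (del_vert u)))"
    using assms unfolding good_def chromatic_number_del_vert by blast
  have "\<exists>p. pre_digraph.apath (with_proj (recoloring_graph G k)) c p (extend c0) \<and>
      (\<forall>x\<in>verts G. recolor_count p x \<le> card (verts G))"
    if k: "k \<ge> chromatic_number G + 1" and c: "c \<in> colorings G k" for k c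
  proof -
    let ?r = "restrict c (verts G - {u})"
    obtain p where p: "recoloring_walk (del_vert u) k ?r p c0"
      "\<And>x. x \<in> verts G - {u} \<Longrightarrow> recolor_count p x \<le> card (verts G) - 1"
      using reach[OF k restrict_coloring[OF c]] u_in
      by (auto simp: pre_digraph.apath_def del_vert_simps)
    obtain q where q: "recoloring_walk G k (extend ?r) q (extend c0)"
      "\<And>y. recolor_count q y \<le> recolor_count p (if y = u then v else y)"
      using recoloring_walk_extend[OF p(1)] by blast
    let ?w = "recolor_step c (extend ?r) @ q"
    obtain w where w: "pre_digraph.apath (with_proj (recoloring_graph G k)) c w (extend c0)"
      "\<And>x. recolor_count w x \<le> recolor_count ?w x"
      using recoloring_apath_of_walk[OF recoloring_walk_append[OF
            recoloring_walk_extend_restrict(1)[OF c] q(1)]] by blast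
    have "recolor_count w x \<le> card (verts G)" if "x \<in> verts G" for x
    proof -
      \<comment> \<open>For \<open>x = u\<close> the bound is that of \<open>v\<close>, a vertex of
        \<open>G - u\<close>.\<close>
      have "recolor_count q x \<le> card (verts G) - 1"
        using q(2)[of x] p(2)[of "if x = u then v else x"] that v_in u_neq_v
        by (auto split: if_splits)
      \<comment> \<open>Positivity keeps the subtraction from truncating: at most
        \<open>card (verts G) - 1\<close> recolorings in \<open>q\<close> and one before it give at
        most \<open>card (verts G)\<close>.\<close>
      moreover have "card (verts G) > 0" using u_in by (auto simp: card_gt_0_iff)
      ultimately show ?thesis
        using w(2)[of x] by (auto simp: recolor_count_append recolor_count_step split: split_of_bool_asm)
    qed
    with w(1) show ?thesis by blast
  qed
  then show ?thesis using extend_coloring[OF c0] unfolding good_def by blast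
qed

end

theorem lemma3:
  fixes G :: "('a, 'b) pre_digraph" and u v :: 'a
  assumes "graph G"
    and "u \<in> verts G" and "v \<in> verts G" and "u \<noteq> v"
    and "\<not> u \<rightarrow>\<^bsub>G\<^esub> v"
    and "neighborhood G u \<subseteq> neighborhood G v"
  shows "(recolorable G \<or> \<not> recolorable (pre_digraph.del_vert G u)) \<and>
    (good (pre_digraph.del_vert G u) \<longrightarrow> good G)"
proof -
  interpret graph G by fact
  interpret dominated_vertex G u v by unfold_locales fact+
  show ?thesis
    using recolorable_if_recolorable_del_vert good_if_good_del_vert by blast
qed

end
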